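(* Let $F\in\mathbb{N}\setminus\{0\}$, let $S\in\mathcal{A}(F)$ be such that $\mathcal{A}(F)_{\mathrm{rank}}(S)=m(S)-1$, and let $A$ be its $\mathcal{A}(F)$-minimal system of generators. Then $$g(S)=\frac{1}{m(S)}\left(\sum_{a\in(A\setminus\{m(S)\})\cup\{F\}}a\right)-\frac{m(S)-3}{2}.$$
   Context: Let $\mathbb{N}=\{0,1,2,\dots\}$. A numerical semigroup is a subset $S\subseteq\mathbb{N}$ that contains $0$, is closed under addition, and has finite complement $\mathbb{N}\setminus S$. Its multiplicity is $m(S)=\min(S\setminus\{0\})$, its Frobenius number is $F(S)=\max\{z\in\mathbb{Z}\mid z\notin S\}$, and its genus is $g(S)=\sharp(\mathbb{N}\setminus S)$, where $\sharp$ denotes cardinality. For $F\in\mathbb{N}\setminus\{0\}$, $\mathcal{A}(F)$ is the set of all numerical semigroups with Frobenius number $F$; its minimum with respect to inclusion is $\Delta(\mathcal{A}(F))=\{0\}\cup\{z\in\mathbb{N}\mid z\ge F+1\}$. An $\mathcal{A}(F)$-set is a subset of $M\setminus\Delta(\mathcal{A}(F))$ for some maximal (with respect to inclusion) element $M$ of $\mathcal{A}(F)$. For an $\mathcal{A}(F)$-set $B$, $\mathcal{A}(F)(B)$ denotes the intersection of all elements of $\mathcal{A}(F)$ containing $B$ (it is the least element of $\mathcal{A}(F)$ containing $B$). An $\mathcal{A}(F)$-minimal system of generators of $S\in\mathcal{A}(F)$ is an $\mathcal{A}(F)$-set $B$ with $\mathcal{A}(F)(B)=S$ and $\mathcal{A}(F)(B')\neq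 S$ for all $B'\subsetneq B$; every $S\in\mathcal{A}(F)$ has exactly one. The $\mathcal{A}(F)$-rank of $S$ is $\mathcal{A}(F)_{\mathrm{rank}}(S)=\min\{\sharp B\mid B\text{ is an }\mathcal{A}(F)\text{-set and }\mathcal{A}(F)(B)=S\}$. *)

theory Defs
  imports Complex_Main
begin

definition numerical_semigroup :: "nat set \<Rightarrow> bool" where
  "numerical_semigroup S \<longleftrightarrow>
     0 \<in> S \<and> (\<forall>x\<in>S. \<forall>y\<in>S. x + y \<in> S) \<and> finite (UNIV - S)"

definition multiplicity_sg :: "nat set \<Rightarrow> nat" where
  "multiplicity_sg S = (LEAST n. n \<in> S - {0})"

text \<open>The maximum is taken over the integers not in \<open>S\<close>, so the semigroup of all natural
  numbers has Frobenius number -1.\<close>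

definition frobenius_number :: "nat set \<Rightarrow> int" where
  "frobenius_number S = (GREATEST z. z \<notin> int ` S)"

definition genus :: "nat set \<Rightarrow> nat" where
  "genus S = card (UNIV - S)"

definition \<A> :: "nat \<Rightarrow> nat set set" where
  "\<A> F = {S. numerical_semigroup S \<and> frobenius_number S = int F}"

definition \<Delta> :: "nat \<Rightarrow> nat set" where
  "\<Delta> F = {0} \<union> {z. z \<ge> F + 1}"

definition maximal_\<A> :: "nat \<Rightarrow> nat set \<Rightarrow> bool" where
  "maximal_\<A> F M \<longleftrightarrow> M \<in> \<A> F \<and> \<not> (\<exists>T\<in>\<A> F. M \<subset> T)"

definition \<A>_set :: "nat \<Rightarrow> nat set \<Rightarrow> bool" where
  "\<A>_set F B \<longleftrightarrow> (\<exists>M. maximal_\<A> F M \<and> B \<subseteq> M - \<Delta> F)"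

definition \<A>_generated :: "nat \<Rightarrow> nat set \<Rightarrow> nat set" where
  "\<A>_generated F B = \<Inter>{T \<in> \<A> F. B \<subseteq> T}"

definition \<A>_minimal_system :: "nat \<Rightarrow> nat set \<Rightarrow> nat set \<Rightarrow> bool" where
  "\<A>_minimal_system F S B \<longleftrightarrow>
     \<A>_set F B \<and> \<A>_generated F B = S \<and> (\<forall>B'. B' \<subset> B \<longrightarrow> \<A>_generated F B' \<noteq> S)"

definition \<A>_rank :: "nat \<Rightarrow> nat set \<Rightarrow> nat" where
  "\<A>_rank F S = (LEAST n. \<exists>B. \<A>_set F B \<and> \<A>_generated F B = S \<and> n = card B)"

end

theory Submission
  imports Defs
begin

text \<open>The elements of \<open>A\<close> are exactly the irreducible elements of \<open>S\<close> below \<open>F\<close>, so the rank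
  is \<open>card A\<close>. For \<open>a \<in> A\<close> with \<open>a \<noteq> m\<close>, where \<open>m\<close> is the multiplicity, \<open>a - m \<notin> S\<close>; hence
  \<open>a\<close> is an Apery element of \<open>S\<close> with respect to \<open>m\<close>, and so are \<open>0\<close> and \<open>F + m\<close>. If
  \<open>card A = m - 1\<close>, these are \<open>m\<close> elements, hence the whole Apery set, and Selmer's formula
  \<open>g = (sum of the Apery set) / m - (m - 1) / 2\<close> gives the claim.\<close>

section \<open>Membership in \<open>\<A> F\<close> through the gaps of a semigroup\<close>

lemma mem_\<A>_iff:
  "S \<in> \<A> F \<longleftrightarrow> numerical_semigroup S \<and> F \<notin> S \<and> (\<forall>n>F. n \<in> S)"
proof (cases "numerical_semigroup S")
  case True
  \<comment> \<open>Every negative integer is missing from \<open>S\<close>, so the set behind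
    \<open>frobenius_number\<close> is infinite. Cutting it at -1 leaves a finite nonempty set with
    the same greatest element, to which \<open>Max\<close> applies.\<close>
  define Z where "Z = {z. z \<notin> int ` S \<and> z \<ge> -1}"
  have "Z \<subseteq> insert (-1) (int ` (UNIV - S))"
  proof
    fix z assume z: "z \<in> Z"
    show "z \<in> insert (-1) (int ` (UNIV - S))"
    proof (cases "z = -1")
      case False
      with z have "z = int (nat z)" by (auto simp: Z_def)
      moreover have "nat z \<in> UNIV - S" using calculation z unfolding Z_def by fastforce
      ultimately show ?thesis by blast
    qed simp
  qed
  moreover have "finite (UNIV - S)" using True by (simp add: numerical_semigroup_def)
  ultimately have fin: "finite Z" by (meson finite.insertI finite_imageI finite_subset)
  have "-1 \<in> Z" by (auto simp: Z_def)
  then have Max_in: "Max Z \<in> Z" using fin Max_in by blast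
  have "(GREATEST z. z \<notin> int ` S) = Max Z"
  proof (rule Greatest_equality)
    show "Max Z \<notin> int ` S" using Max_in by (simp add: Z_def)
  next
    fix y assume y: "y \<notin> int ` S"
    show "y \<le> Max Z"
    proof (cases "y \<ge> -1")
      case True
      then have "y \<in> Z" using y by (simp add: Z_def)
      then show ?thesis using fin by simp
    next
      case False
      then show ?thesis using Max_in by (simp add: Z_def)
    qed
  qed
  then have frob: "frobenius_number S = Max Z" by (simp add: frobenius_number_def)
  have "Max Z = int F \<longleftrightarrow> F \<notin> S \<and> (\<forall>n>F. n \<in> S)"
  proof
    assume eq: "Max Z = int F"
    have "F \<notin> S" using Max_in eq by (auto simp: Z_def)
    moreover have "n \<in> S" if "n > F" for n
    proof (rule ccontr)
      assume "n \<notin> S"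
      then have "int n \<in> Z" by (auto simp: Z_def)
      then have "int n \<le> Max Z" using fin by simp
      then show False using eq that by simp
    qed
    ultimately show "F \<notin> S \<and> (\<forall>n>F. n \<in> S)" by blast
  next
    assume r: "F \<notin> S \<and> (\<forall>n>F. n \<in> S)"
    show "Max Z = int F"
    proof (rule Max_eqI[OF fin])
      show "int F \<in> Z" using r by (auto simp: Z_def)
    next
      fix y assume y: "y \<in> Z"
      show "y \<le> int F"
      proof (rule ccontr)
        assume "\<not> y \<le> int F"
        then have "nat y > F" "y = int (nat y)" by auto
        then show False using r y unfolding Z_def by blast
      qed
    qed
  qed
  then show ?thesis using True frob by (simp add: \<A>_def)
qed (simp add: \<A>_def)

section \<open>Irreducible elements and generating systems\<close>

definition irreducibles :: "nat set \<Rightarrow> nat set" where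
  "irreducibles S = {x \<in> S - {0}. \<forall>y\<in>S - {0}. \<forall>z\<in>S - {0}. x \<noteq> y + z}"

text \<open>No sum of two remaining elements can equal \<open>x\<close>, so closure survives the
  deletion; since \<open>x < F\<close>, the elements above \<open>F\<close> are untouched and the
  Frobenius number stays \<open>F\<close>.\<close>

lemma \<A>_remove_irreducible:
  assumes "S \<in> \<A> F" "x \<in> irreducibles S" "x < F"
  shows "S - {x} \<in> \<A> F"
proof -
  have S: "numerical_semigroup S" "F \<notin> S" "\<forall>n>F. n \<in> S"
    using assms(1) by (auto simp: mem_\<A>_iff)
  have "y + z \<noteq> x" if "y \<in> S - {x}" "z \<in> S - {x}" for y z
    using that assms(2) by (cases "y = 0 \<or> z = 0") (auto simp: irreducibles_def)
  moreover have "finite (UNIV - (S - {x}))"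
  proof -
    have "UNIV - (S - {x}) \<subseteq> insert x (UNIV - S)" by auto
    then show ?thesis
      using S(1) by (meson finite.insertI finite_subset numerical_semigroup_def)
  qed
  ultimately have "numerical_semigroup (S - {x})"
    using S(1) assms(2) by (auto simp: numerical_semigroup_def irreducibles_def)
  then show ?thesis using S assms(3) by (auto simp: mem_\<A>_iff)
qed

lemma \<A>_generated_superset: "B \<subseteq> \<A>_generated F B"
  by (auto simp: \<A>_generated_def)

text \<open>If \<open>B\<close> missed such an \<open>x\<close>, then \<open>S - {x}\<close> would
  take part in the intersection, and \<open>x\<close> would be lost from \<open>S\<close>.\<close>

lemma irreducibles_subset_generators:
  assumes "S \<in> \<A> F" "\<A>_generated F B = S"
  shows "irreducibles S \<inter> {..<F} \<subseteq> B"
proof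
  fix x assume x: "x \<in> irreducibles S \<inter> {..<F}"
  have "B \<subseteq> S" using \<A>_generated_superset assms(2) by blast
  show "x \<in> B"
  proof (rule ccontr)
    assume "x \<notin> B"
    then have "B \<subseteq> S - {x}" using \<open>B \<subseteq> S\<close> by auto
    then have "\<A>_generated F B \<subseteq> S - {x}"
      using \<A>_remove_irreducible[OF assms(1), of x] x by (auto simp: \<A>_generated_def)
    then show False using assms(2) x by (auto simp: irreducibles_def)
  qed
qed

text \<open>By strong induction each element of \<open>S\<close> decomposes into irreducibles. Those
  above \<open>F\<close> lie in every member of \<open>\<A> F\<close> anyway, and \<open>F\<close>
  itself is not in \<open>S\<close>, so only those below \<open>F\<close> matter.\<close>

lemma \<A>_generated_irreducibles:
  assumes "S \<in> \<A> F"
  shows "\<A>_generated F (irreducibles S \<inter> {..<F}) = S"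
proof
  show "\<A>_generated F (irreducibles S \<inter> {..<F}) \<subseteq> S"
    using assms by (auto simp: \<A>_generated_def irreducibles_def)
next
  have "x \<in> T" if T: "T \<in> \<A> F" "irreducibles S \<inter> {..<F} \<subseteq> T" and "x \<in> S" for x T
    using \<open>x \<in> S\<close>
  proof (induction x rule: less_induct)
    case (less x)
    have TT: "0 \<in> T" "\<And>y z. y \<in> T \<Longrightarrow> z \<in> T \<Longrightarrow> y + z \<in> T" "\<And>n. n > F \<Longrightarrow> n \<in> T"
      using T(1) by (auto simp: mem_\<A>_iff numerical_semigroup_def)
    have "x \<noteq> F" using less.prems assms by (auto simp: mem_\<A>_iff)
    consider "x = 0" | "x > F" | "x \<in> irreducibles S" "x < F"
      | y z where "y \<in> S - {0}" "z \<in> S - {0}" "x = y + z"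
    proof (cases "x \<in> irreducibles S \<or> x = 0")
      case True
      then show thesis using that(1-3) \<open>x \<noteq> F\<close> by (meson linorder_neqE_nat)
    next
      case False
      then show thesis using that(4) less.prems unfolding irreducibles_def by blast
    qed
    then show "x \<in> T"
    proof cases
      case 4
      then show ?thesis using less.IH TT(2) by auto
    qed (use TT T(2) in auto)
  qed
  then show "S \<subseteq> \<A>_generated F (irreducibles S \<inter> {..<F})"
    by (auto simp: \<A>_generated_def)
qed

lemma \<A>_minimal_system_eq:
  assumes "S \<in> \<A> F" "\<A>_minimal_system F S A"
  shows "A = irreducibles S \<inter> {..<F}"
  using irreducibles_subset_generators[OF assms(1), of A] \<A>_generated_irreducibles[OF assms(1)]
    assms(2) by (metis \<A>_minimal_system_def psubsetI)

text \<open>Excludes infinite generating sets, whose \<open>card\<close> would be 0 by convention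
  and would falsify the rank comparison.\<close>

lemma finite_\<A>_set: "\<A>_set F B \<Longrightarrow> finite B"
  unfolding \<A>_set_def \<Delta>_def by (rule finite_subset[of _ "{..F}"]) auto

lemma \<A>_rank_eq_card:
  assumes "S \<in> \<A> F" "\<A>_minimal_system F S A"
  shows "\<A>_rank F S = card A"
  unfolding \<A>_rank_def
proof (rule Least_equality)
  show "\<exists>B. \<A>_set F B \<and> \<A>_generated F B = S \<and> card A = card B"
    using assms(2) by (auto simp: \<A>_minimal_system_def)
next
  fix n assume "\<exists>B. \<A>_set F B \<and> \<A>_generated F B = S \<and> n = card B"
  then obtain B where B: "\<A>_set F B" "\<A>_generated F B = S" "n = card B" by blast
  have "A \<subseteq> B"
    using irreducibles_subset_generators[OF assms(1) B(2)] \<A>_minimal_system_eq[OF assms] by simp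
  then show "card A \<le> n" using B finite_\<A>_set card_mono by blast
qed

section \<open>Apery sets and Selmer's formula\<close>

definition apery :: "nat set \<Rightarrow> nat \<Rightarrow> nat \<Rightarrow> nat" where
  "apery S m i = (LEAST n. n \<in> S \<and> n mod m = i)"

context
  fixes S :: "nat set" and m :: nat
  assumes S: "numerical_semigroup S" and m: "m \<in> S" "m > 0"
begin

lemma add_mult_mem: "x \<in> S \<Longrightarrow> x + k * m \<in> S"
proof (induction k)
  case (Suc k)
  then have "(x + k * m) + m \<in> S"
    using S m(1) unfolding numerical_semigroup_def by blast
  then show ?case by (simp add: algebra_simps)
qed simp

lemma mem_of_le_mod_eq:
  assumes "x \<in> S" "x \<le> y" "x mod m = y mod m"
  shows "y \<in> S"
proof -
  have "m dvd y - x" using assms(2,3) mod_eq_dvd_iff_nat[of x y m] by simp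
  then obtain k where "y - x = m * k" by (auto simp: dvd_def)
  then have "y = x + k * m" using assms(2) by (simp add: mult.commute)
  then show ?thesis using add_mult_mem assms(1) by simp
qed

lemma apery_mem_mod:
  assumes "i < m"
  shows "apery S m i \<in> S" "apery S m i mod m = i"
proof -
  have "finite (UNIV - S)" using S by (simp add: numerical_semigroup_def)
  then obtain N where N: "\<forall>n\<in>UNIV - S. n < N" using finite_nat_set_iff_bounded by auto
  \<comment> \<open>This witness has residue \<open>i\<close> and lies beyond all gaps, so the
    \<open>LEAST\<close> in \<open>apery\<close> is attained.\<close>
  have "N \<le> i + N * m" using m(2) by (simp add: trans_le_add2)
  then have "i + N * m \<in> S" using N by (meson DiffI UNIV_I linorder_not_less)
  moreover have "(i + N * m) mod m = i" using assms by simp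
  ultimately have "apery S m i \<in> S \<and> apery S m i mod m = i"
    unfolding apery_def
    using LeastI[of "\<lambda>n. n \<in> S \<and> n mod m = i" "i + N * m"] by blast
  then show "apery S m i \<in> S" "apery S m i mod m = i" by auto
qed

text \<open>Adding \<open>m\<close> stays in \<open>S\<close>, so within a residue class
  \<open>S\<close> consists of everything from its Apery element upwards.\<close>

lemma mem_iff_apery_le: "n \<in> S \<longleftrightarrow> apery S m (n mod m) \<le> n"
proof
  assume "n \<in> S"
  then show "apery S m (n mod m) \<le> n" unfolding apery_def by (intro Least_le) simp
next
  assume "apery S m (n mod m) \<le> n"
  then show "n \<in> S" using mem_of_le_mod_eq apery_mem_mod[of "n mod m"] m(2) by simp
qed

text \<open>Links the residue-indexed \<open>apery\<close> to the usual description by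
  \<open>w - m\<close>. A smaller element of \<open>S\<close> in the class of \<open>w\<close> would
  be at most \<open>w - m\<close> and force \<open>w - m\<close> into \<open>S\<close>. The case
  \<open>w < m\<close> is separate because subtraction truncates.\<close>

lemma apery_eqI:
  assumes "w \<in> S" "w < m \<or> w - m \<notin> S"
  shows "apery S m (w mod m) = w"
proof (rule ccontr)
  let ?a = "apery S m (w mod m)"
  assume "?a \<noteq> w"
  have a: "?a \<in> S" "?a mod m = w mod m" using apery_mem_mod m(2) by auto
  have "?a < w" using mem_iff_apery_le assms(1) \<open>?a \<noteq> w\<close> by (meson le_neq_implies_less)
  then have "m dvd w - ?a" using a(2) mod_eq_dvd_iff_nat[of ?a w m] by simp
  then have "m \<le> w - ?a" using \<open>?a < w\<close> by (simp add: dvd_imp_le)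
  then have "?a \<le> w - m" "m \<le> w" using \<open>?a < w\<close> by auto
  moreover have "(w - m) mod m = w mod m" using \<open>m \<le> w\<close> by (simp add: le_mod_geq)
  ultimately have "w - m \<in> S" using mem_of_le_mod_eq[OF a(1)] a(2) by simp
  then show False using assms(2) \<open>m \<le> w\<close> by simp
qed

lemma inj_on_apery: "inj_on (apery S m) {..<m}"
  by (metis apery_mem_mod(2) inj_onI lessThan_iff)

text \<open>The gaps with residue \<open>i\<close> are \<open>i\<close>, \<open>i + m\<close>,
  \<open>i + 2 * m\<close> and so on, up to but excluding the Apery element; the quotient counts
  them.\<close>

lemma genus_eq_sum_apery_div: "genus S = (\<Sum>i<m. apery S m i div m)"
proof -
  let ?G = "\<lambda>i. {n. n mod m = i \<and> n < apery S m i}"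
  have "UNIV - S = (\<Union>i<m. ?G i)" using mem_iff_apery_le m(2) by auto
  then have "genus S = (\<Sum>i<m. card (?G i))"
    unfolding genus_def by (subst card_UN_disjoint[symmetric]) auto
  also have "\<dots> = (\<Sum>i<m. apery S m i div m)"
  proof (rule sum.cong)
    fix i assume "i \<in> {..<m}"
    then have i: "i < m" by simp
    have eq: "apery S m i = i + m * (apery S m i div m)"
      using apery_mem_mod(2)[OF i] mod_mult_div_eq[of "apery S m i" m] by simp
    have "?G i = (\<lambda>k. i + m * k) ` {..<apery S m i div m}"
    proof (intro set_eqI iffI)
      fix n assume n: "n \<in> ?G i"
      then have n_eq: "n = i + m * (n div m)" using mod_mult_div_eq[of n m] by auto
      then have "i + m * (n div m) < i + m * (apery S m i div m)" using n eq by auto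
      then have "n div m < apery S m i div m" by simp
      then show "n \<in> (\<lambda>k. i + m * k) ` {..<apery S m i div m}" using n_eq by blast
    next
      fix n assume "n \<in> (\<lambda>k. i + m * k) ` {..<apery S m i div m}"
      then obtain k where k: "k < apery S m i div m" "n = i + m * k" by auto
      then have "n < i + m * (apery S m i div m)" using m(2) by simp
      then have "n < apery S m i" using eq by linarith
      then show "n \<in> ?G i" using k(2) i by simp
    qed
    then show "card (?G i) = apery S m i div m"
      using m(2) by (simp add: card_image inj_on_def)
  qed simp
  finally show ?thesis .
qed

text \<open>Divide each Apery element by \<open>m\<close> with remainder: the quotients add up to
  the genus, the remainders to \<open>m * (m - 1) / 2\<close>.\<close>

lemma selmer_genus:
  "real (genus S) = (\<Sum>w\<in>apery S m ` {..<m}. real w) / real m - (real m - 1) / 2"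
proof -
  have "(\<Sum>w\<in>apery S m ` {..<m}. real w) = (\<Sum>i<m. real (apery S m i))"
    by (simp add: sum.reindex inj_on_apery)
  also have "\<dots> = (\<Sum>i<m. real m * real (apery S m i div m) + real i)"
  proof (rule sum.cong)
    fix i assume "i \<in> {..<m}"
    then have "apery S m i = m * (apery S m i div m) + i"
      using apery_mem_mod(2)[of i] mult_div_mod_eq[of m "apery S m i"] by simp
    then show "real (apery S m i) = real m * real (apery S m i div m) + real i"
      by (metis of_nat_add of_nat_mult)
  qed simp
  also have "\<dots> = real m * real (genus S) + (\<Sum>i<m. real i)"
    by (simp add: genus_eq_sum_apery_div sum.distrib sum_distrib_left)
  also have "(\<Sum>i<m. real i) = real m * (real m - 1) / 2"
    by (induction m) (auto simp: field_simps)
  finally show ?thesis using m(2) by (simp add: field_simps)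
qed

end

section \<open>The multiplicity and the genus formula\<close>

lemma multiplicity_sg:
  assumes "numerical_semigroup S"
  shows "multiplicity_sg S \<in> S" "multiplicity_sg S > 0"
    "\<And>n. n \<in> S \<Longrightarrow> n > 0 \<Longrightarrow> multiplicity_sg S \<le> n"
proof -
  have "finite (UNIV - S)" using assms by (simp add: numerical_semigroup_def)
  then have "infinite (S - {0})"
    by (metis Diff_infinite_finite finite.emptyI finite.insertI finite_Diff2 infinite_UNIV_nat)
  then obtain n where "n \<in> S - {0}" by (metis ex_in_conv finite.emptyI)
  then have "multiplicity_sg S \<in> S - {0}" unfolding multiplicity_sg_def by (rule LeastI)
  then show "multiplicity_sg S \<in> S" "multiplicity_sg S > 0" by auto
  show "\<And>n. n \<in> S \<Longrightarrow> n > 0 \<Longrightarrow> multiplicity_sg S \<le> n"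
    unfolding multiplicity_sg_def by (intro Least_le) simp
qed

lemma multiplicity_irreducible:
  assumes "numerical_semigroup S"
  shows "multiplicity_sg S \<in> irreducibles S"
proof -
  have "multiplicity_sg S \<noteq> y + z" if "y \<in> S - {0}" "z \<in> S - {0}" for y z
    using multiplicity_sg(3)[OF assms, of y] that by auto
  then show ?thesis using multiplicity_sg(1,2)[OF assms] by (simp add: irreducibles_def)
qed

theorem proposition6p20:
  fixes F :: nat and S A :: "nat set"
  assumes "F \<noteq> 0"
    and "S \<in> \<A> F"
    and "int (\<A>_rank F S) = int (multiplicity_sg S) - 1"
    and "\<A>_minimal_system F S A"
  shows "real (genus S) =
    1 / real (multiplicity_sg S) * (\<Sum>a\<in>(A - {multiplicity_sg S}) \<union> {F}. real a)
      - (real (multiplicity_sg S) - 3) / 2"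
proof -
  define m where "m = multiplicity_sg S"
  have S: "numerical_semigroup S" "F \<notin> S" "\<And>n. n > F \<Longrightarrow> n \<in> S"
    using assms(2) by (auto simp: mem_\<A>_iff)
  have m: "m \<in> S" "m > 0" using multiplicity_sg[OF S(1)] by (auto simp: m_def)
  have A: "A = irreducibles S \<inter> {..<F}" by (rule \<A>_minimal_system_eq[OF assms(2,4)])
  then have finA: "finite A" by simp
  have cardA: "card A + 1 = m"
    using assms(3) \<A>_rank_eq_card[OF assms(2,4)] by (simp add: m_def)
  \<comment> \<open>Otherwise \<open>m > F \<ge> 1\<close>, so the rank condition makes
    \<open>A\<close> nonempty; but its elements would have to be at least \<open>m\<close> and below
    \<open>F\<close>.\<close>
  have "m < F"
  proof (rule ccontr)
    assume "\<not> m < F"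
    then have "m > F" using m(1) S(2) by (metis linorder_neqE_nat)
    then have "m \<ge> 2" using assms(1) by simp
    then have "card A \<noteq> 0" using cardA by simp
    then obtain a where "a \<in> A" by (metis card.empty ex_in_conv)
    then have "m \<le> a" "a < F"
      using A multiplicity_sg(3)[OF S(1)] by (auto simp: irreducibles_def m_def)
    then show False using \<open>m > F\<close> by simp
  qed
  then have mA: "m \<in> A" using A multiplicity_irreducible[OF S(1)] by (simp add: m_def)
  let ?B = "A - {m}"
  let ?W = "insert 0 (insert (F + m) ?B)"
  have notin: "0 \<notin> ?B" "F + m \<notin> ?B" "F \<notin> ?B" using A by (auto simp: irreducibles_def)
  \<comment> \<open>Exactly two residue classes are left for \<open>0\<close> and
    \<open>F + m\<close>.\<close>
  have "card ?B + 2 = m"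
    using cardA card_Suc_Diff1[OF finA mA] by simp
  then have "card ?W = m" using notin finA m(2) by simp
  have "w \<in> apery S m ` {..<m}" if "w \<in> ?W" for w
  proof -
    have "w \<in> S \<and> (w < m \<or> w - m \<notin> S)"
    proof -
      consider "w = 0" | "w = F + m" | "w \<in> ?B" using \<open>w \<in> ?W\<close> by auto
      then show ?thesis
      proof cases
        case 1
        then show ?thesis using S(1) m(2) by (simp add: numerical_semigroup_def)
      next
        case 2
        then show ?thesis using S m(2) by simp
      next
        case 3
        then have w: "w \<in> irreducibles S" "w \<noteq> m" using A by auto
        \<comment> \<open>Otherwise \<open>w\<close> would split as \<open>(w - m) + m\<close>,
          where \<open>w \<noteq> m\<close> makes the first summand nonzero.\<close>
        have "w - m \<notin> S" if "w \<ge> m"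
        proof
          assume "w - m \<in> S"
          then have "w - m \<in> S - {0}" "m \<in> S - {0}" "w = (w - m) + m"
            using that w(2) m by auto
          then show False using w(1) unfolding irreducibles_def by blast
        qed
        then show ?thesis using w(1) by (auto simp: irreducibles_def)
      qed
    qed
    then have "w = apery S m (w mod m)" using apery_eqI[OF S(1) m] by simp
    then show ?thesis using m(2) by (metis imageI lessThan_iff mod_less_divisor)
  qed
  then have "?W \<subseteq> apery S m ` {..<m}" by blast
  moreover have "card (apery S m ` {..<m}) = m"
    using inj_on_apery[OF S(1) m] by (simp add: card_image)
  ultimately have "apery S m ` {..<m} = ?W"
    using \<open>card ?W = m\<close> by (metis card_subset_eq finite_imageI finite_lessThan)
  \<comment> \<open>Trading \<open>F + m\<close> for \<open>F\<close> leaves a surplus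
    \<open>m\<close>, which contributes 1 after division by \<open>m\<close> and turns
    \<open>(m - 1) / 2\<close> into \<open>(m - 3) / 2\<close>.\<close>
  then have "(\<Sum>w\<in>apery S m ` {..<m}. real w) = (\<Sum>a\<in>?B \<union> {F}. real a) + real m"
    using notin finA m(2) by simp
  then show ?thesis
    using selmer_genus[OF S(1) m] m(2) unfolding m_def[symmetric] by (simp add: field_simps)
qed

end
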